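(* Let $t\ge 0$ be an integer and $i\in\{1,2\}$. The value $\operatorname{var}(g_{t,i}^b\mid\mathcal{F}_0)$ can be written as a polynomial in $\frac1b$ with no constant term: there exist an integer $r\le 2\cdot 3^{t+1}$ and constants $\beta_1,\dots,\beta_r\in\mathbb{R}$, all independent of $b$, such that for every mini-batch size $b\ge1$ $$\operatorname{var}\left(g_{t,i}^b\,\middle|\,\mathcal{F}_0\right)=\beta_1\frac1b+\cdots+\beta_r\frac1{b^r}.$$
   Context: Online SGD on a two-layer linear network. Fixed ground-truth (teacher) matrices $W_1^*,W_2^*$ and student weights $W_1\in\mathbb{R}^{p_1\times p}$, $W_2\in\mathbb{R}^{p_2\times p_1}$ ($W_1^*,W_2^*$ have compatible sizes, with $W_2^*W_1^*\in\mathbb{R}^{p_2\times p}$); the loss is $\mathbb{E}_{x\sim N(0,I_p)}[\frac12\|W_2W_1x-W_2^*W_1^*x\|^2]$. For mini-batch size $b\ge1$, start from fixed $W_{0,1}^b=W_{0,1}$, $W_{0,2}^b=W_{0,2}$ independent of $b$. At each iteration $t\ge0$ draw fresh samples $x_{t,1},\dots,x_{t,b}$ i.i.d. from $N(0,I_p)$ (independent across iterations) and set $W_{t+1,i}^b=W_{t,i}^b-\alpha_t g_{t,i}^b$ for $i=1,2$, where, with $\mathcal{W}_t^b=W_{t,2}^bW_{t,1}^b-W_2^*W_1^*$, $$g_{t,1}^b=\frac1b\sum_{i=1}^b (W_{t,2}^b)^\top\mathcal{W}_t^b x_{t,i}x_{t,i}^\top,\qquad g_{t,2}^b=\frac1b\sum_{i=1}^b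 \mathcal{W}_t^b x_{t,i}x_{t,i}^\top (W_{t,1}^b)^\top .$$ The learning rates $\alpha_t>0$ are independent of $b$. $\mathcal{F}_0$ is the information consisting of the initial weights only. For a random matrix $Z$, $\operatorname{var}(Z\mid\mathcal{F}_0)=\mathbb{E}[\|\mathrm{vec}(Z)\|^2\mid\mathcal{F}_0]-\|\mathbb{E}[\mathrm{vec}(Z)\mid\mathcal{F}_0]\|^2$, a scalar, where $\mathrm{vec}$ is vectorization and $\|\cdot\|$ the Euclidean norm. *)

theory Defs
  imports "HOL-Probability.Probability"
begin

text \<open>A network is the pair of its layers \<open>(W\<^sub>1, W\<^sub>2)\<close>. The index types \<open>'p\<close>, \<open>'h\<close>, \<open>'o\<close>, \<open>'k\<close>
  carry the dimensions: input, student hidden layer, output, teacher hidden layer.\<close>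

definition residual ::
  "(real^'p^'k) \<times> (real^'k^'o) \<Rightarrow> (real^'p^'h) \<times> (real^'h^'o) \<Rightarrow> real^'p^'o" where
  "residual T W = snd W ** fst W - snd T ** fst T"

definition outer_square :: "real^'p \<Rightarrow> real^'p^'p" where
  "outer_square v = (columnvector v :: real^1^'p) ** (rowvector v :: real^'p^1)"

text \<open>Stochastic gradients for the mini-batch \<open>\<xi> 1, \<dots>, \<xi> b\<close>.\<close>

definition batch_grad1 ::
  "(real^'p^'k) \<times> (real^'k^'o) \<Rightarrow> nat \<Rightarrow> (nat \<Rightarrow> real^'p)
    \<Rightarrow> (real^'p^'h) \<times> (real^'h^'o) \<Rightarrow> real^'p^'h" where
  "batch_grad1 T b \<xi> W =
     (1 / real b) *\<^sub>R (\<Sum>i\<in>{1..b}. transpose (snd W) ** residual T W ** outer_square (\<xi> i))"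

definition batch_grad2 ::
  "(real^'p^'k) \<times> (real^'k^'o) \<Rightarrow> nat \<Rightarrow> (nat \<Rightarrow> real^'p)
    \<Rightarrow> (real^'p^'h) \<times> (real^'h^'o) \<Rightarrow> real^'h^'o" where
  "batch_grad2 T b \<xi> W =
     (1 / real b) *\<^sub>R (\<Sum>i\<in>{1..b}. residual T W ** outer_square (\<xi> i) ** transpose (fst W))"

text \<open>Here \<open>X t i\<close> is the random \<open>i\<close>-th sample of iteration \<open>t\<close>.\<close>

primrec sgd_weights ::
  "(real^'p^'k) \<times> (real^'k^'o) \<Rightarrow> (nat \<Rightarrow> real) \<Rightarrow> (real^'p^'h) \<times> (real^'h^'o) \<Rightarrow> nat
    \<Rightarrow> (nat \<Rightarrow> nat \<Rightarrow> 'w \<Rightarrow> real^'p) \<Rightarrow> nat \<Rightarrow> 'w \<Rightarrow> (real^'p^'h) \<times> (real^'h^'o)" where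
  "sgd_weights T \<alpha> W0 b X 0 = (\<lambda>\<omega>. W0)"
| "sgd_weights T \<alpha> W0 b X (Suc t) = (\<lambda>\<omega>.
     let W = sgd_weights T \<alpha> W0 b X t \<omega> in
       (fst W - \<alpha> t *\<^sub>R batch_grad1 T b (\<lambda>i. X t i \<omega>) W,
        snd W - \<alpha> t *\<^sub>R batch_grad2 T b (\<lambda>i. X t i \<omega>) W))"

definition sgd_grad1 ::
  "(real^'p^'k) \<times> (real^'k^'o) \<Rightarrow> (nat \<Rightarrow> real) \<Rightarrow> (real^'p^'h) \<times> (real^'h^'o) \<Rightarrow> nat
    \<Rightarrow> (nat \<Rightarrow> nat \<Rightarrow> 'w \<Rightarrow> real^'p) \<Rightarrow> nat \<Rightarrow> 'w \<Rightarrow> real^'p^'h" where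
  "sgd_grad1 T \<alpha> W0 b X t \<omega> = batch_grad1 T b (\<lambda>i. X t i \<omega>) (sgd_weights T \<alpha> W0 b X t \<omega>)"

definition sgd_grad2 ::
  "(real^'p^'k) \<times> (real^'k^'o) \<Rightarrow> (nat \<Rightarrow> real) \<Rightarrow> (real^'p^'h) \<times> (real^'h^'o) \<Rightarrow> nat
    \<Rightarrow> (nat \<Rightarrow> nat \<Rightarrow> 'w \<Rightarrow> real^'p) \<Rightarrow> nat \<Rightarrow> 'w \<Rightarrow> real^'h^'o" where
  "sgd_grad2 T \<alpha> W0 b X t \<omega> = batch_grad2 T b (\<lambda>i. X t i \<omega>) (sgd_weights T \<alpha> W0 b X t \<omega>)"

text \<open>The sigma-algebra generated by the initial weights. As these are deterministic, it is the
  trivial one.\<close>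

definition initial_info ::
  "'w measure \<Rightarrow> (real^'p^'k) \<times> (real^'k^'o) \<Rightarrow> (nat \<Rightarrow> real) \<Rightarrow> (real^'p^'h) \<times> (real^'h^'o) \<Rightarrow> nat
    \<Rightarrow> (nat \<Rightarrow> nat \<Rightarrow> 'w \<Rightarrow> real^'p) \<Rightarrow> 'w measure" where
  "initial_info M T \<alpha> W0 b X = vimage_algebra (space M) (sgd_weights T \<alpha> W0 b X 0) borel"

text \<open>Density of \<open>N(0, I)\<close>: the coordinates are independent standard normal variables.\<close>

definition std_normal_vec_density :: "real^'p \<Rightarrow> real" where
  "std_normal_vec_density v = (\<Prod>j\<in>UNIV. std_normal_density (v $ j))"

definition vectorize :: "real^'n^'m \<Rightarrow> real^('m \<times> 'n)" where
  "vectorize Z = (\<chi> ij. Z $ fst ij $ snd ij)"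

definition vec_cond_exp ::
  "'w measure \<Rightarrow> 'w measure \<Rightarrow> ('w \<Rightarrow> real^'n) \<Rightarrow> 'w \<Rightarrow> real^'n" where
  "vec_cond_exp M F Y \<omega> = (\<chi> j. real_cond_exp M F (\<lambda>\<omega>'. Y \<omega>' $ j) \<omega>)"

definition cond_var ::
  "'w measure \<Rightarrow> 'w measure \<Rightarrow> ('w \<Rightarrow> real^'n^'m) \<Rightarrow> 'w \<Rightarrow> real" where
  "cond_var M F Z \<omega> =
     real_cond_exp M F (\<lambda>\<omega>'. (norm (vectorize (Z \<omega>')))\<^sup>2) \<omega>
     - (norm (vec_cond_exp M F (\<lambda>\<omega>'. vectorize (Z \<omega>')) \<omega>))\<^sup>2"

end

theory Submission
  imports Defs
begin

text \<open>Let \<open>S\<^sub>s = (1/b) \<Sum>\<^sub>a x\<^sub>s\<^sub>,\<^sub>a x\<^sub>s\<^sub>,\<^sub>a\<^sup>T\<close> be the empirical second moment matrix of iteration \<open>s\<close>. By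
  induction the entries of the gradient at time \<open>t\<close> are polynomials in the entries of
  \<open>S\<^sub>0, \<dots>, S\<^sub>t\<close> of degree at most \<open>3\<^sup>t\<^sup>+\<^sup>1 - 1\<close>, with coefficients independent of \<open>b\<close>.

  The rows \<open>(x\<^sub>s\<^sub>,\<^sub>a)\<^sub>s\<close>, \<open>a = 1, \<dots>, b\<close>, are i.i.d. Hence the expectation of a product of \<open>m\<close> entries
  is \<open>b\<^sup>-\<^sup>m\<close> times a sum over all maps from the \<open>m\<close> factors to the rows, whose terms depend only on
  the partition of the factors into fibres. A partition into \<open>k\<close> fibres arises from
  \<open>b (b - 1) \<dots> (b - k + 1)\<close> maps, so the expectation is a polynomial in \<open>1/b\<close> of degree at most
  \<open>m\<close>. Its constant term comes from \<open>k = m\<close> alone and is the product of the expectations of the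
  factors. The constant term of the expectation is therefore multiplicative on polynomials in the
  entries, so the contributions of \<open>E \<parallel>g\<parallel>\<^sup>2\<close> and \<open>\<parallel>E g\<parallel>\<^sup>2\<close> to the constant term of the variance
  cancel.\<close>

subsection \<open>Sums over allocations\<close>

text \<open>Sum, over the ordered partitions of \<open>R\<close> into \<open>k\<close> nonempty
  blocks, of the product of \<open>\<mu>\<close> over the blocks. \<open>R - A\<close> is the block
  split off first; excluding \<open>A = R\<close> keeps it nonempty.\<close>

primrec ordered_partition_sum :: "('r set \<Rightarrow> real) \<Rightarrow> nat \<Rightarrow> 'r set \<Rightarrow> real" where
  "ordered_partition_sum \<mu> 0 R = of_bool (R = {})"
| "ordered_partition_sum \<mu> (Suc k) R =
     (\<Sum>A\<in>Pow R - {R}. \<mu> (R - A) * ordered_partition_sum \<mu> k A)"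

text \<open>Every block uses up at least one element.\<close>

lemma ordered_partition_sum_eq_0:
  "finite R \<Longrightarrow> card R < k \<Longrightarrow> ordered_partition_sum \<mu> k R = 0"
proof (induction k arbitrary: R)
  case (Suc k)
  have "ordered_partition_sum \<mu> k A = 0" if "A \<in> Pow R - {R}" for A
  proof (rule Suc.IH)
    have "A \<subset> R" using that by auto
    then show "finite A" "card A < k"
      using Suc.prems psubset_card_mono[of R A] by (auto intro: finite_subset)
  qed
  then show ?case by simp
qed simp

text \<open>With as many blocks as elements all blocks are singletons, and only their order is
  free.\<close>

lemma ordered_partition_sum_card:
  "finite R \<Longrightarrow> ordered_partition_sum \<mu> (card R) R = fact (card R) * (\<Prod>r\<in>R. \<mu> {r})"
proof (induction "card R" arbitrary: R)
  case (Suc k)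
  have fin: "finite R" and card: "card R = Suc k"
    using Suc by auto
  let ?g = "\<lambda>A. \<mu> (R - A) * ordered_partition_sum \<mu> k A"
  \<comment> \<open>Only the removal of a single element survives: any smaller \<open>A\<close> has
    fewer than \<open>k\<close> elements and contributes 0.\<close>
  have "ordered_partition_sum \<mu> (Suc k) R = (\<Sum>A\<in>(\<lambda>r. R - {r}) ` R. ?g A)"
    unfolding ordered_partition_sum.simps
  proof (intro sum.mono_neutral_right ballI)
    fix A assume A: "A \<in> Pow R - {R} - (\<lambda>r. R - {r}) ` R"
    then have sub: "A \<subset> R" by auto
    then obtain r where r: "r \<in> R" "r \<notin> A" by auto
    have "A \<subset> R - {r}" using A r sub by blast
    then have "card A < k"
      using psubset_card_mono[of "R - {r}" A] fin card r by simp
    then show "?g A = 0"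
      using ordered_partition_sum_eq_0[of A k \<mu>] finite_subset[of A R] sub fin by auto
  qed (use fin in auto)
  also have "\<dots> = (\<Sum>r\<in>R. \<mu> (R - (R - {r})) * ordered_partition_sum \<mu> k (R - {r}))"
    by (subst sum.reindex) (auto simp: inj_on_def)
  also have "\<dots> = (\<Sum>r\<in>R. fact k * (\<Prod>r\<in>R. \<mu> {r}))"
  proof (rule sum.cong)
    fix r assume r: "r \<in> R"
    have "R - (R - {r}) = {r}" using r by auto
    moreover have "ordered_partition_sum \<mu> k (R - {r}) = fact k * (\<Prod>r\<in>R - {r}. \<mu> {r})"
      using Suc(1)[of "R - {r}"] fin card r by simp
    ultimately show "\<mu> (R - (R - {r})) * ordered_partition_sum \<mu> k (R - {r})
        = fact k * (\<Prod>r\<in>R. \<mu> {r})"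
      using prod.remove[OF fin r, of "\<lambda>r. \<mu> {r}"] by simp
  qed simp
  finally show ?case
    by (simp add: card Suc(2)[symmetric])
qed simp

text \<open>This is the sum of \<open>\<Prod>c\<in>{1..n}. \<mu> (f -` {c} \<inter> R)\<close> over all \<open>f : R \<rightarrow> {1..n}\<close> (when
  \<open>\<mu> {} = 1\<close>), grouped by the set of the \<open>k\<close> values that \<open>f\<close> takes.\<close>

definition allocation_sum :: "('r set \<Rightarrow> real) \<Rightarrow> nat \<Rightarrow> 'r set \<Rightarrow> real" where
  "allocation_sum \<mu> n R = (\<Sum>k\<le>n. real (n choose k) * ordered_partition_sum \<mu> k R)"

lemma allocation_sum_0: "allocation_sum \<mu> 0 R = of_bool (R = {})"
  by (simp add: allocation_sum_def)

text \<open>\<open>R - A\<close> is the fibre of the last value. The summand \<open>A = R\<close>,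
  where this value is not taken, is where \<open>\<mu> {} = 1\<close> enters.\<close>

lemma allocation_sum_Suc:
  assumes "finite R" and "\<mu> {} = 1"
  shows "allocation_sum \<mu> (Suc n) R = (\<Sum>A\<in>Pow R. \<mu> (R - A) * allocation_sum \<mu> n A)"
proof -
  let ?c = "ordered_partition_sum \<mu>"
  have "allocation_sum \<mu> (Suc n) R = ?c 0 R + (\<Sum>k\<le>n. real (Suc n choose Suc k) * ?c (Suc k) R)"
    unfolding allocation_sum_def by (subst sum.atMost_Suc_shift) simp
  \<comment> \<open>Pascal's rule. The terms with \<open>n choose Suc k\<close> rebuild
    \<open>allocation_sum \<mu> n R\<close>, the summand \<open>A = R\<close>; in those with
    \<open>n choose k\<close> one block is unfolded, which gives the proper subsets.\<close>
  also have "\<dots> = (?c 0 R + (\<Sum>k\<le>n. real (n choose Suc k) * ?c (Suc k) R))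
      + (\<Sum>k\<le>n. real (n choose k) * ?c (Suc k) R)"
    by (simp add: sum.distrib algebra_simps del: ordered_partition_sum.simps)
  also have "?c 0 R + (\<Sum>k\<le>n. real (n choose Suc k) * ?c (Suc k) R)
      = (\<Sum>k\<le>Suc n. real (n choose k) * ?c k R)"
    by (subst sum.atMost_Suc_shift) simp
  also have "\<dots> = allocation_sum \<mu> n R"
    by (simp add: allocation_sum_def)
  also have "(\<Sum>k\<le>n. real (n choose k) * ?c (Suc k) R)
      = (\<Sum>A\<in>Pow R - {R}. \<mu> (R - A) * allocation_sum \<mu> n A)"
    unfolding allocation_sum_def ordered_partition_sum.simps sum_distrib_left
    by (subst sum.swap) (simp add: ac_simps)
  also have "allocation_sum \<mu> n R + \<dots> = (\<Sum>A\<in>Pow R. \<mu> (R - A) * allocation_sum \<mu> n A)"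
    using assms by (subst (2) sum.remove[of _ R]) auto
  finally show ?thesis .
qed

text \<open>Drawing \<open>b\<close> out of each factor of the falling factorial leaves the factors
  \<open>1 - j / b\<close>; the \<open>m - k\<close> surplus powers of \<open>1 / b\<close> form the
  monomial.\<close>

lemma binomial_div_power_poly:
  assumes "k \<le> m" and "b \<ge> 1"
  shows "real (b choose k) / real b ^ m
    = poly (smult (1 / fact k) (monom 1 (m - k) * (\<Prod>j<k. [:1, - real j:]))) (1 / real b)"
proof -
  have "(\<Prod>j<k. real b - real j) = (\<Prod>j<k. real b * (1 - real j / real b))"
    using assms by (intro prod.cong) (auto simp: field_simps)
  also have "\<dots> = real b ^ k * (\<Prod>j<k. 1 - real j / real b)"
    by (simp add: prod.distrib)
  finally have "real (b choose k) = real b ^ k * (\<Prod>j<k. 1 - real j / real b) / fact k"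
    by (simp add: binomial_gbinomial gbinomial_prod_rev atLeast0LessThan)
  moreover have "real b ^ m = real b ^ k * real b ^ (m - k)"
    using assms by (simp flip: power_add)
  ultimately show ?thesis
    using assms by (simp add: poly_monom poly_prod field_simps)
qed

lemma allocation_sum_poly:
  assumes "finite R"
  obtains p :: "real poly" where "degree p \<le> card R" "coeff p 0 = (\<Prod>r\<in>R. \<mu> {r})"
    "\<And>b. b \<ge> 1 \<Longrightarrow> allocation_sum \<mu> b R / real b ^ card R = poly p (1 / real b)"
proof
  let ?m = "card R"
  define q :: "nat \<Rightarrow> real poly"
    where "q k = smult (1 / fact k) (monom 1 (?m - k) * (\<Prod>j<k. [:1, - real j:]))" for k
  define p where "p = (\<Sum>k\<le>?m. smult (ordered_partition_sum \<mu> k R) (q k))"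
  have "degree (q k) \<le> ?m" if "k \<le> ?m" for k
  proof -
    have "degree (\<Prod>j<k. [:1, - real j:]) \<le> k"
      by (induction k) (auto simp del: mult_pCons_right intro!: order.trans[OF degree_mult_le])
    then have "degree (monom (1::real) (?m - k) * (\<Prod>j<k. [:1, - real j:])) \<le> (?m - k) + k"
      by (intro order.trans[OF degree_mult_le] add_mono degree_monom_le)
    then show ?thesis using that by (simp add: q_def)
  qed
  then show "degree p \<le> ?m"
    unfolding p_def by (intro degree_sum_le) (auto intro: order.trans[OF degree_smult_le])
  \<comment> \<open>The monomial in \<open>q k\<close> vanishes at 0 unless
    \<open>k = ?m\<close>.\<close>
  have "coeff (q k) 0 = (if k = ?m then 1 / fact k else 0)" if "k \<le> ?m" for k
    using that by (auto simp: q_def poly_monom poly_prod simp flip: poly_0_coeff_0)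
  then have "coeff p 0
      = (\<Sum>k\<le>?m. if k = ?m then ordered_partition_sum \<mu> k R * (1 / fact k) else 0)"
    unfolding p_def coeff_sum by (intro sum.cong) auto
  also have "\<dots> = (\<Prod>r\<in>R. \<mu> {r})"
    using ordered_partition_sum_card[OF assms, of \<mu>] by simp
  finally show "coeff p 0 = (\<Prod>r\<in>R. \<mu> {r})" .
  show "allocation_sum \<mu> b R / real b ^ ?m = poly p (1 / real b)" if "b \<ge> 1" for b
  proof -
    let ?g = "\<lambda>k. real (b choose k) * ordered_partition_sum \<mu> k R"
    \<comment> \<open>The binomial vanishes for \<open>k > b\<close> and the partition sum for
      \<open>k > ?m\<close>, so the range of summation can be made independent of
      \<open>b\<close>.\<close>
    have "allocation_sum \<mu> b R = (\<Sum>k\<le>max b ?m. ?g k)"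
      unfolding allocation_sum_def by (intro sum.mono_neutral_left) auto
    also have "\<dots> = (\<Sum>k\<le>?m. ?g k)"
      using ordered_partition_sum_eq_0[OF assms] by (intro sum.mono_neutral_right) auto
    finally have "allocation_sum \<mu> b R / real b ^ ?m
        = (\<Sum>k\<le>?m. ordered_partition_sum \<mu> k R * (real (b choose k) / real b ^ ?m))"
      by (simp add: sum_divide_distrib mult.commute)
    also have "\<dots> = poly p (1 / real b)"
      unfolding p_def poly_sum poly_smult
      by (intro sum.cong refl) (simp add: q_def binomial_div_power_poly[OF _ that] del: poly_smult)
    finally show ?thesis .
  qed
qed

subsection \<open>Moments of batch sums\<close>

context prob_space
begin

context
  fixes X :: "nat \<times> nat \<Rightarrow> 'a \<Rightarrow> 'v :: topological_space"
    and b :: nat and N :: "'v measure" and h :: "'r \<Rightarrow> 'v \<Rightarrow> real" and \<sigma> :: "'r \<Rightarrow> nat"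
  assumes indep: "indep_vars (\<lambda>_. borel) X (UNIV \<times> {1..b})"
    and law: "\<And>s i. i \<in> {1..b} \<Longrightarrow> distr M borel (X (s, i)) = N"
    and h_meas [measurable]: "\<And>r. h r \<in> borel_measurable borel"
    and h_int: "\<And>B. finite B \<Longrightarrow> integrable N (\<lambda>v. \<Prod>r\<in>B. h r v)"
begin

text \<open>Grouped by the iteration \<open>\<sigma> r\<close>, the factors become functions of
  distinct samples, hence independent. As every sample has law \<open>N\<close>, the value is the
  same for all rows \<open>a\<close>.\<close>

lemma row_moment:
  assumes "finite A" and a: "a \<in> {1..b}"
  shows "integrable M (\<lambda>\<omega>. \<Prod>r\<in>A. h r (X (\<sigma> r, a) \<omega>))" (is ?int)
    and "expectation (\<lambda>\<omega>. \<Prod>r\<in>A. h r (X (\<sigma> r, a) \<omega>))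
      = (\<Prod>s\<in>\<sigma> ` A. \<integral>v. (\<Prod>r | r \<in> A \<and> \<sigma> r = s. h r v) \<partial>N)" (is ?eq)
proof -
  let ?I = "(\<lambda>r. (\<sigma> r, a)) ` A"
  let ?H = "\<lambda>q v. \<Prod>r | r \<in> A \<and> (\<sigma> r, a) = q. h r v"
  have X_meas: "X q \<in> borel_measurable M" if "q \<in> UNIV \<times> {1..b}" for q
    using indep that by (auto simp: indep_vars_def)
  have H_meas [measurable]: "?H q \<in> borel_measurable borel" for q
    by measurable
  have split: "(\<Prod>r\<in>A. h r (X (\<sigma> r, a) \<omega>)) = (\<Prod>q\<in>?I. ?H q (X q \<omega>))" for \<omega>
    by (subst prod.image_gen[OF \<open>finite A\<close>, of _ "\<lambda>r. (\<sigma> r, a)"]) (auto intro!: prod.cong)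
  have ind: "indep_vars (\<lambda>_. borel) (\<lambda>q \<omega>. ?H q (X q \<omega>)) ?I"
    by (rule indep_vars_compose2[OF indep_vars_subset[OF indep]]) (use a in auto)
  have N_eq: "distr M borel (X q) = N" if "q \<in> ?I" for q
    using law a that by auto
  have int: "integrable M (\<lambda>\<omega>. ?H q (X q \<omega>))" if "q \<in> ?I" for q
  proof -
    have "integrable (distr M borel (X q)) (?H q)"
      using N_eq[OF that] h_int \<open>finite A\<close> by simp
    then show ?thesis
      by (subst (asm) integrable_distr_eq) (use X_meas that a in auto)
  qed
  have fin: "finite ?I" using \<open>finite A\<close> by simp
  show ?int
    unfolding split by (intro indep_vars_integrable fin ind int)
  have "expectation (\<lambda>\<omega>. ?H q (X q \<omega>)) = (\<integral>v. ?H q v \<partial>N)" if "q \<in> ?I" for q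
    unfolding N_eq[OF that, symmetric]
    by (subst integral_distr) (use X_meas that a in auto)
  then have "expectation (\<lambda>\<omega>. \<Prod>r\<in>A. h r (X (\<sigma> r, a) \<omega>)) = (\<Prod>q\<in>?I. \<integral>v. ?H q v \<partial>N)"
    unfolding split by (subst indep_vars_lebesgue_integral[OF fin ind int]) auto
  also have "?I = (\<lambda>s. (s, a)) ` \<sigma> ` A" by auto
  also have "(\<Prod>q\<in>\<dots>. \<integral>v. ?H q v \<partial>N)
      = (\<Prod>s\<in>\<sigma> ` A. \<integral>v. (\<Prod>r | r \<in> A \<and> \<sigma> r = s. h r v) \<partial>N)"
    by (subst prod.reindex) (auto simp: inj_on_def)
  finally show ?eq .
qed

text \<open>Rows are added one at a time while \<open>b\<close> stays fixed. Expanding the product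
  gives the new row the factors outside \<open>B\<close>, which reproduces the recursion of
  \<open>allocation_sum_Suc\<close>.\<close>

lemma batch_moment:
  assumes "finite A" and "n \<le> b"
  shows "integrable M (\<lambda>\<omega>. \<Prod>r\<in>A. \<Sum>a=1..n. h r (X (\<sigma> r, a) \<omega>)) \<and>
    expectation (\<lambda>\<omega>. \<Prod>r\<in>A. \<Sum>a=1..n. h r (X (\<sigma> r, a) \<omega>))
      = allocation_sum
          (\<lambda>B. \<Prod>s\<in>\<sigma> ` B. \<integral>v. (\<Prod>r | r \<in> B \<and> \<sigma> r = s. h r v) \<partial>N) n A"
  using assms
proof (induction n arbitrary: A)
  case 0
  \<comment> \<open>The inner sums are empty, so the product is 0 unless \<open>A\<close> is
    empty.\<close>
  then show ?case
    by (cases "A = {}") (auto simp: allocation_sum_0 prob_space prod_zero_iff)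
next
  case (Suc n)
  define \<mu> where "\<mu> B = (\<Prod>s\<in>\<sigma> ` B. \<integral>v. (\<Prod>r | r \<in> B \<and> \<sigma> r = s. h r v) \<partial>N)" for B
  let ?P = "\<lambda>B \<omega>. \<Prod>r\<in>B. \<Sum>a=1..n. h r (X (\<sigma> r, a) \<omega>)"
  let ?Q = "\<lambda>B \<omega>. \<Prod>r\<in>B. h r (X (\<sigma> r, Suc n) \<omega>)"
  let ?K = "UNIV \<times> {1..n}" and ?L = "UNIV \<times> {Suc n} :: (nat \<times> nat) set"
  have IH: "integrable M (?P B)" "expectation (?P B) = allocation_sum \<mu> n B" if "B \<subseteq> A" for B
    using Suc.IH[of B] Suc.prems finite_subset[OF that] by (auto simp: \<mu>_def[abs_def])
  have Q: "integrable M (?Q B)" "expectation (?Q B) = \<mu> B" if "B \<subseteq> A" for B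
    using row_moment[of B "Suc n"] Suc.prems finite_subset[OF that] by (auto simp: \<mu>_def)
  \<comment> \<open>The first \<open>n\<close> rows and row \<open>Suc n\<close> use disjoint sets
    of samples.\<close>
  have ind: "indep_var borel (?P B) borel (?Q C)" for B C
  proof -
    have "indep_var borel ((\<lambda>z. \<Prod>r\<in>B. \<Sum>a=1..n. h r (z (\<sigma> r, a)))
            \<circ> (\<lambda>\<omega>. restrict (\<lambda>q. X q \<omega>) ?K))
          borel ((\<lambda>z. \<Prod>r\<in>C. h r (z (\<sigma> r, Suc n))) \<circ> (\<lambda>\<omega>. restrict (\<lambda>q. X q \<omega>) ?L))"
    proof (rule indep_var_compose[OF indep_var_restrict[OF indep]])
      show "(\<lambda>z. \<Prod>r\<in>B. \<Sum>a=1..n. h r (z (\<sigma> r, a))) \<in> borel_measurable (PiM ?K (\<lambda>_. borel))"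
        by (intro borel_measurable_prod borel_measurable_sum measurable_compose[OF _ h_meas]
            measurable_component_singleton) auto
      show "(\<lambda>z. \<Prod>r\<in>C. h r (z (\<sigma> r, Suc n))) \<in> borel_measurable (PiM ?L (\<lambda>_. borel))"
        by (intro borel_measurable_prod measurable_compose[OF _ h_meas]
            measurable_component_singleton) auto
    qed (use Suc.prems in auto)
    then show ?thesis by (simp add: o_def)
  qed
  have expand: "(\<Prod>r\<in>A. \<Sum>a=1..Suc n. h r (X (\<sigma> r, a) \<omega>))
      = (\<Sum>B\<in>Pow A. ?P B \<omega> * ?Q (A - B) \<omega>)" for \<omega>
    using prod_add[OF Suc.prems(1), of "\<lambda>r. \<Sum>a=1..n. h r (X (\<sigma> r, a) \<omega>)"] by simp
  have int: "integrable M (\<lambda>\<omega>. ?P B \<omega> * ?Q (A - B) \<omega>)" if "B \<in> Pow A" for B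
    using that by (intro indep_var_integrable[OF ind] IH Q) auto
  have "expectation (\<lambda>\<omega>. \<Prod>r\<in>A. \<Sum>a=1..Suc n. h r (X (\<sigma> r, a) \<omega>))
      = (\<Sum>B\<in>Pow A. expectation (\<lambda>\<omega>. ?P B \<omega> * ?Q (A - B) \<omega>))"
    unfolding expand by (rule Bochner_Integration.integral_sum) (rule int)
  also have "\<dots> = (\<Sum>B\<in>Pow A. \<mu> (A - B) * allocation_sum \<mu> n B)"
  proof (rule sum.cong)
    fix B assume "B \<in> Pow A"
    then show "expectation (\<lambda>\<omega>. ?P B \<omega> * ?Q (A - B) \<omega>) = \<mu> (A - B) * allocation_sum \<mu> n B"
      using indep_var_lebesgue_integral[OF ind, of B "A - B"] IH[of B] Q[of "A - B"] by auto
  qed simp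
  also have "\<dots> = allocation_sum \<mu> (Suc n) A"
    by (subst allocation_sum_Suc) (use Suc.prems in \<open>auto simp: \<mu>_def\<close>)
  finally show ?case
    using int unfolding expand \<mu>_def[abs_def] by (auto intro!: Bochner_Integration.integrable_sum)
qed

end

end

subsection \<open>Moments of the standard normal vector\<close>

text \<open>Lebesgue measure on \<open>real^'p\<close> is the image of a product of one-dimensional
  ones indexed by \<open>Basis\<close>. What remains is to rename basis vectors as
  coordinates.\<close>

lemma integrable_lborel_vec_prod:
  fixes g :: "'p::finite \<Rightarrow> real \<Rightarrow> real"
  assumes "\<And>j. integrable lborel (g j)"
  shows "integrable lborel (\<lambda>v::real^'p. \<Prod>j\<in>UNIV. g j (v $ j))"
proof -
  let ?e = "\<lambda>j::'p. axis j (1::real)"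
  interpret product_sigma_finite "\<lambda>_::real^'p. lborel :: real measure" ..
  have inj: "inj ?e" by (auto simp: inj_def axis_eq_axis)
  have Basis: "(Basis :: (real^'p) set) = range ?e" by (auto simp: Basis_vec_def)
  have [measurable]: "g j \<in> borel_measurable borel" for j
    using assms[of j] by simp
  have comp: "(\<Sum>b\<in>Basis. f b * b $ j) = f (?e j)" for f :: "real^'p \<Rightarrow> real" and j
  proof -
    have "(\<Sum>b\<in>Basis. f b * b $ j) = (\<Sum>i\<in>UNIV. f (?e i) * ?e i $ j)"
      unfolding Basis by (subst sum.reindex[OF inj]) simp
    also have "\<dots> = f (?e j)"
      by (simp add: axis_def if_distrib cong: if_cong)
    finally show ?thesis .
  qed
  have "integrable (\<Pi>\<^sub>M b\<in>Basis. lborel) (\<lambda>f. \<Prod>b\<in>Basis. g (inv ?e b) (f b))"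
    by (intro product_integrable_prod assms) simp
  also have "(\<lambda>f. \<Prod>b\<in>Basis. g (inv ?e b) (f b)) = (\<lambda>f. \<Prod>j\<in>UNIV. g j (f (?e j)))"
    unfolding Basis by (subst prod.reindex[OF inj]) (simp add: inv_f_f[OF inj])
  finally show ?thesis
    by (subst lborel_eq, subst integrable_distr_eq) (simp_all add: comp)
qed

lemma integrable_std_normal_vec_density_monomial:
  fixes j k :: "'r \<Rightarrow> 'p::finite"
  assumes "finite B"
  shows "integrable lborel
    (\<lambda>v::real^'p. std_normal_vec_density v * (\<Prod>r\<in>B. v $ j r * v $ k r))"
proof -
  \<comment> \<open>Collecting repeated coordinates gives one power per coordinate, so
    one-dimensional normal moments suffice.\<close>
  have power: "(\<Prod>r\<in>B. v $ i r) = (\<Prod>q\<in>UNIV. v $ q ^ card {r \<in> B. i r = q})"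
    for v :: "real^'p" and i
    by (subst prod.group[OF assms, of UNIV i, symmetric]) auto
  have "integrable lborel (\<lambda>v::real^'p. \<Prod>q\<in>UNIV.
      std_normal_density (v $ q) * v $ q ^ (card {r \<in> B. j r = q} + card {r \<in> B. k r = q}))"
    by (intro integrable_lborel_vec_prod integrable_std_normal_moment)
  then show ?thesis
    by (simp add: std_normal_vec_density_def prod.distrib power power_add mult.assoc)
qed

lemma std_normal_vec_density_nonneg: "std_normal_vec_density v \<ge> 0"
  unfolding std_normal_vec_density_def by (intro prod_nonneg) simp

lemma borel_measurable_std_normal_vec_density [measurable]:
  "std_normal_vec_density \<in> borel_measurable borel"
  unfolding std_normal_vec_density_def[abs_def] by measurable

definition std_normal_vec :: "(real^'p) measure" where
  "std_normal_vec = density lborel (\<lambda>v. ennreal (std_normal_vec_density v))"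

lemma integrable_std_normal_vec_monomial:
  fixes j k :: "'r \<Rightarrow> 'p::finite"
  assumes "finite B"
  shows "integrable std_normal_vec (\<lambda>v::real^'p. \<Prod>r\<in>B. v $ j r * v $ k r)"
  unfolding std_normal_vec_def
  by (subst integrable_real_density)
    (auto simp: std_normal_vec_density_nonneg integrable_std_normal_vec_density_monomial[OF assms])

subsection \<open>Polynomials in batch means\<close>

text \<open>The family \<open>f b\<close> is a polynomial of degree at most \<open>d\<close> in the variables \<open>S b i\<close>, with
  coefficients independent of \<open>b\<close>, and \<open>c\<close> is its value under the substitution \<open>S b i \<mapsto> C i\<close>.
  Below, \<open>C i\<close> is the expectation of \<open>S b i\<close>.\<close>

inductive poly_family ::
  "(nat \<Rightarrow> 'i \<Rightarrow> 'w \<Rightarrow> real) \<Rightarrow> ('i \<Rightarrow> real) \<Rightarrow> nat \<Rightarrow> real \<Rightarrow> (nat \<Rightarrow> 'w \<Rightarrow> real) \<Rightarrow> bool"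
  for S :: "nat \<Rightarrow> 'i \<Rightarrow> 'w \<Rightarrow> real" and C :: "'i \<Rightarrow> real"
where
  const: "poly_family S C d c (\<lambda>b \<omega>. c)"
| add: "poly_family S C d c f \<Longrightarrow> poly_family S C d c' g
    \<Longrightarrow> poly_family S C d (c + c') (\<lambda>b \<omega>. f b \<omega> + g b \<omega>)"
| mult_var: "poly_family S C d c f \<Longrightarrow> poly_family S C (Suc d) (C i * c) (\<lambda>b \<omega>. S b i \<omega> * f b \<omega>)"

lemma poly_family_mono: "poly_family S C d c f \<Longrightarrow> d \<le> d' \<Longrightarrow> poly_family S C d' c f"
proof (induction arbitrary: d' rule: poly_family.induct)
  case (mult_var d c f i)
  then obtain e where "d' = Suc e" "d \<le> e" by (cases d') auto
  with mult_var.IH show ?case by (auto intro: poly_family.mult_var)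
qed (auto intro: poly_family.const poly_family.add)

lemma poly_family_scale: "poly_family S C d c f \<Longrightarrow> poly_family S C d (a * c) (\<lambda>b \<omega>. a * f b \<omega>)"
proof (induction rule: poly_family.induct)
  case (mult_var d c f i)
  from poly_family.mult_var[OF mult_var.IH, of i] show ?case
    by (simp add: mult.left_commute)
qed (auto simp: distrib_left intro: poly_family.const poly_family.add)

lemma poly_family_mult:
  assumes "poly_family S C d c f" and g: "poly_family S C e c' g"
  shows "poly_family S C (d + e) (c * c') (\<lambda>b \<omega>. f b \<omega> * g b \<omega>)"
  using assms(1)
proof (induction rule: poly_family.induct)
  case (const d c)
  show ?case by (rule poly_family_mono[OF poly_family_scale[OF g]]) simp
next
  case (mult_var d c f i)
  from poly_family.mult_var[OF mult_var.IH, of i] show ?case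
    by (simp add: mult.assoc)
qed (auto simp: distrib_right intro: poly_family.add)

lemma poly_family_sum:
  "finite A \<Longrightarrow> (\<And>a. a \<in> A \<Longrightarrow> poly_family S C d (c a) (f a))
    \<Longrightarrow> poly_family S C d (\<Sum>a\<in>A. c a) (\<lambda>b \<omega>. \<Sum>a\<in>A. f a b \<omega>)"
  by (induction A rule: finite_induct) (auto intro: poly_family.const poly_family.add)

text \<open>The value \<open>c\<close> matters only for the constant term of the variance. Hiding it
  leaves just the degrees to be tracked through the recursion.\<close>

definition polynomial_in ::
  "(nat \<Rightarrow> 'i \<Rightarrow> 'w \<Rightarrow> real) \<Rightarrow> ('i \<Rightarrow> real) \<Rightarrow> nat \<Rightarrow> (nat \<Rightarrow> 'w \<Rightarrow> real) \<Rightarrow> bool"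
where
  "polynomial_in S C d f \<longleftrightarrow> (\<exists>c. poly_family S C d c f)"

lemma polynomial_in_const: "polynomial_in S C d (\<lambda>b \<omega>. c)"
  unfolding polynomial_in_def by (blast intro: poly_family.const)

lemma polynomial_in_mono: "polynomial_in S C d f \<Longrightarrow> d \<le> d' \<Longrightarrow> polynomial_in S C d' f"
  unfolding polynomial_in_def by (blast intro: poly_family_mono)

lemma polynomial_in_mult: "polynomial_in S C d f \<Longrightarrow> polynomial_in S C e g \<Longrightarrow> polynomial_in S C (d + e) (\<lambda>b \<omega>. f b \<omega> * g b \<omega>)"
  unfolding polynomial_in_def by (blast intro: poly_family_mult)

lemma polynomial_in_sum: "finite A \<Longrightarrow> (\<And>a. a \<in> A \<Longrightarrow> polynomial_in S C d (f a)) \<Longrightarrow> polynomial_in S C d (\<lambda>b \<omega>. \<Sum>a\<in>A. f a b \<omega>)"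
  unfolding polynomial_in_def by (metis poly_family_sum)

lemma polynomial_in_diff_scale: "polynomial_in S C d f \<Longrightarrow> polynomial_in S C d g \<Longrightarrow> polynomial_in S C d (\<lambda>b \<omega>. f b \<omega> - r * g b \<omega>)"
  unfolding polynomial_in_def using poly_family.add[OF _ poly_family_scale, of S C d _ f _ g "- r"]
  by auto

lemma (in prob_space) expectation_poly_family:
  assumes monomial: "\<And>l. \<exists>p :: real poly. degree p \<le> length l \<and> coeff p 0 = (\<Prod>i\<leftarrow>l. C i) \<and>
      (\<forall>b\<ge>1. integrable M (\<lambda>\<omega>. \<Prod>i\<leftarrow>l. S b i \<omega>)
        \<and> expectation (\<lambda>\<omega>. \<Prod>i\<leftarrow>l. S b i \<omega>) = poly p (1 / real b))"
    and "poly_family S C d c f"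
  shows "\<exists>p :: real poly. degree p \<le> d \<and> coeff p 0 = c \<and>
    (\<forall>b\<ge>1. integrable M (f b) \<and> expectation (f b) = poly p (1 / real b))"
proof -
  \<comment> \<open>Expectation is not multiplicative, so the induction carries an arbitrary
    monomial \<open>l\<close> as prefactor; in the case \<open>mult_var\<close> the new variable
    joins \<open>l\<close>.\<close>
  have "\<exists>p :: real poly. degree p \<le> length l + d \<and> coeff p 0 = (\<Prod>i\<leftarrow>l. C i) * c \<and>
    (\<forall>b\<ge>1. integrable M (\<lambda>\<omega>. (\<Prod>i\<leftarrow>l. S b i \<omega>) * f b \<omega>) \<and>
      expectation (\<lambda>\<omega>. (\<Prod>i\<leftarrow>l. S b i \<omega>) * f b \<omega>) = poly p (1 / real b))" for l
    using assms(2)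
  proof (induction arbitrary: l rule: poly_family.induct)
    case (const d c)
    from monomial[of l] obtain p :: "real poly" where
      "degree p \<le> length l" "coeff p 0 = (\<Prod>i\<leftarrow>l. C i)"
      "\<forall>b\<ge>1. integrable M (\<lambda>\<omega>. \<Prod>i\<leftarrow>l. S b i \<omega>)
        \<and> expectation (\<lambda>\<omega>. \<Prod>i\<leftarrow>l. S b i \<omega>) = poly p (1 / real b)"
      by blast
    then show ?case
      by (intro exI[of _ "smult c p"]) (auto intro: order.trans[OF degree_smult_le])
  next
    case (add d c f c' g)
    from add.IH(1)[of l] obtain p :: "real poly" where
      p: "degree p \<le> length l + d" "coeff p 0 = (\<Prod>i\<leftarrow>l. C i) * c"
      "\<forall>b\<ge>1. integrable M (\<lambda>\<omega>. (\<Prod>i\<leftarrow>l. S b i \<omega>) * f b \<omega>)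
        \<and> expectation (\<lambda>\<omega>. (\<Prod>i\<leftarrow>l. S b i \<omega>) * f b \<omega>) = poly p (1 / real b)"
      by blast
    from add.IH(2)[of l] obtain q :: "real poly" where
      q: "degree q \<le> length l + d" "coeff q 0 = (\<Prod>i\<leftarrow>l. C i) * c'"
      "\<forall>b\<ge>1. integrable M (\<lambda>\<omega>. (\<Prod>i\<leftarrow>l. S b i \<omega>) * g b \<omega>)
        \<and> expectation (\<lambda>\<omega>. (\<Prod>i\<leftarrow>l. S b i \<omega>) * g b \<omega>) = poly q (1 / real b)"
      by blast
    from p q show ?case
      by (intro exI[of _ "p + q"]) (auto simp: distrib_left intro: degree_add_le)
  next
    case (mult_var d c f i)
    from mult_var.IH[of "i # l"] show ?case
      by (simp add: ac_simps)
  qed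
  from this[of "[]"] show ?thesis by simp
qed

lemma (in prob_space) monomial_batch_mean:
  fixes x :: "nat \<Rightarrow> nat \<Rightarrow> nat \<Rightarrow> 'a \<Rightarrow> 'v :: topological_space"
    and h :: "'r \<Rightarrow> 'v \<Rightarrow> real" and \<sigma> :: "'r \<Rightarrow> nat"
  assumes indep: "\<And>b. b \<ge> 1 \<Longrightarrow> indep_vars (\<lambda>_. borel) (\<lambda>(s, i). x b s i) (UNIV \<times> {1..b})"
    and law: "\<And>b s i. b \<ge> 1 \<Longrightarrow> i \<in> {1..b} \<Longrightarrow> distr M borel (x b s i) = N"
    and h_meas: "\<And>r. h r \<in> borel_measurable borel"
    and h_int: "\<And>(B :: nat set) f. finite B \<Longrightarrow> integrable N (\<lambda>v. \<Prod>n\<in>B. h (f n) v)"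
  shows "\<exists>p :: real poly. degree p \<le> length l \<and> coeff p 0 = (\<Prod>r\<leftarrow>l. \<integral>v. h r v \<partial>N) \<and>
      (\<forall>b\<ge>1. integrable M (\<lambda>\<omega>. \<Prod>r\<leftarrow>l. (\<Sum>a=1..b. h r (x b (\<sigma> r) a \<omega>)) / real b)
        \<and> expectation (\<lambda>\<omega>. \<Prod>r\<leftarrow>l. (\<Sum>a=1..b. h r (x b (\<sigma> r) a \<omega>)) / real b)
          = poly p (1 / real b))"
proof -
  \<comment> \<open>Factors are indexed by their positions in \<open>l\<close>, since a variable may
    occur repeatedly. The block weight \<open>\<mu>\<close> involves \<open>N\<close> but not
    \<open>b\<close>, so one polynomial serves all batch sizes.\<close>
  let ?R = "{..<length l}"
  define \<mu> where "\<mu> B = (\<Prod>s\<in>(\<lambda>n. \<sigma> (l ! n)) ` B.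
    \<integral>v. (\<Prod>n | n \<in> B \<and> \<sigma> (l ! n) = s. h (l ! n) v) \<partial>N)" for B
  have list: "(\<Prod>r\<leftarrow>l. F r) = (\<Prod>n<length l. F (l ! n))" for F :: "'r \<Rightarrow> real"
    by (subst prod.list_conv_set_nth) (simp add: atLeast0LessThan)
  obtain p :: "real poly" where p: "degree p \<le> card ?R" "coeff p 0 = (\<Prod>n\<in>?R. \<mu> {n})"
    "\<And>b. b \<ge> 1 \<Longrightarrow> allocation_sum \<mu> b ?R / real b ^ card ?R = poly p (1 / real b)"
    by (rule allocation_sum_poly[of ?R \<mu>]) auto
  have "\<mu> {n} = (\<integral>v. h (l ! n) v \<partial>N)" for n
  proof -
    have "{m. m = n \<and> \<sigma> (l ! m) = \<sigma> (l ! n)} = {n}" by auto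
    then show ?thesis by (simp add: \<mu>_def)
  qed
  then have "coeff p 0 = (\<Prod>r\<leftarrow>l. \<integral>v. h r v \<partial>N)"
    using p(2) by (simp add: list)
  moreover have "integrable M (\<lambda>\<omega>. \<Prod>r\<leftarrow>l. (\<Sum>a=1..b. h r (x b (\<sigma> r) a \<omega>)) / real b)
        \<and> expectation (\<lambda>\<omega>. \<Prod>r\<leftarrow>l. (\<Sum>a=1..b. h r (x b (\<sigma> r) a \<omega>)) / real b)
          = poly p (1 / real b)" if "b \<ge> 1" for b
  proof -
    have "integrable M (\<lambda>\<omega>. \<Prod>n<length l. \<Sum>a=1..b. h (l ! n) (x b (\<sigma> (l ! n)) a \<omega>))
      \<and> expectation (\<lambda>\<omega>. \<Prod>n<length l. \<Sum>a=1..b. h (l ! n) (x b (\<sigma> (l ! n)) a \<omega>))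
        = allocation_sum \<mu> b ?R"
      using batch_moment[OF indep[OF that], of N "\<lambda>n. h (l ! n)" ?R b "\<lambda>n. \<sigma> (l ! n)"]
        law[OF that] h_meas h_int[of _ "\<lambda>n. l ! n"] by (simp add: \<mu>_def[abs_def])
    then show ?thesis
      using p(3)[OF that] by (simp add: list prod_dividef)
  qed
  ultimately show ?thesis using p(1) by auto
qed

subsection \<open>Conditioning on the initial weights\<close>

text \<open>The characterizing integral identity needs testing only on the empty set and the whole
  space.\<close>

lemma (in prob_space) real_cond_exp_trivial:
  assumes "sets F = {{}, space M}" and "space F = space M" and f: "integrable M f"
  shows "AE \<omega> in M. real_cond_exp M F f \<omega> = expectation f"
proof -
  have "subalgebra M F" using assms by (auto simp: subalgebra_def)
  then interpret finite_measure_subalgebra M F by unfold_locales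
  show ?thesis
  proof (rule real_cond_exp_charact)
    fix A assume "A \<in> sets F"
    then consider "A = {}" | "A = space M" using assms by auto
    then show "(\<integral>\<omega>\<in>A. f \<omega> \<partial>M) = (\<integral>\<omega>\<in>A. expectation f \<partial>M)"
      by cases (simp add: set_lebesgue_integral_def, simp add: set_integral_space f prob_space)
  qed (use f in auto)
qed

text \<open>The initial weights are a constant map, so each preimage is empty or the whole
  space.\<close>

lemma sets_initial_info: "sets (initial_info M T \<alpha> W0 b X) = {{}, space M}"
  and space_initial_info: "space (initial_info M T \<alpha> W0 b X) = space M"
proof -
  show "space (initial_info M T \<alpha> W0 b X) = space M" by (simp add: initial_info_def)
  have "sets (initial_info M T \<alpha> W0 b X) = {(\<lambda>\<omega>. W0) -` A \<inter> space M | A. A \<in> sets borel}"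
    unfolding initial_info_def by (simp add: sets_vimage_algebra2)
  also have "\<dots> = {{}, space M}"
  proof (intro equalityI subsetI)
    fix B assume "B \<in> {{}, space M}"
    then consider "B = {}" | "B = space M" by auto
    then show "B \<in> {(\<lambda>\<omega>. W0) -` A \<inter> space M | A. A \<in> sets borel}"
      by cases (force intro: exI[of _ "{}"] exI[of _ UNIV])+
  qed (auto simp: vimage_const split: if_splits)
  finally show "sets (initial_info M T \<alpha> W0 b X) = {{}, space M}" .
qed

subsection \<open>Entries of the gradients\<close>

lemma outer_square_component: "outer_square v $ j $ k = v $ j * v $ k"
  by (simp add: outer_square_def matrix_matrix_mult_def columnvector_def rowvector_def)

text \<open>Interchanging the sums isolates the batch means of coordinate products. The samples
  enter only through these means, which become the variables of \<open>poly_family\<close>; likewise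
  for the second layer.\<close>

lemma batch_grad1_component:
  "batch_grad1 T b \<xi> W $ i $ j = (\<Sum>q\<in>UNIV. (\<Sum>l\<in>UNIV. snd W $ l $ i * residual T W $ l $ q)
     * ((\<Sum>a=1..b. \<xi> a $ q * \<xi> a $ j) / real b))"
  unfolding batch_grad1_def
  by (simp add: matrix_matrix_mult_def transpose_def outer_square_component sum_divide_distrib)
    (subst sum.swap, simp add: sum_divide_distrib sum_distrib_left)

lemma batch_grad2_component:
  "batch_grad2 T b \<xi> W $ i $ j = (\<Sum>q\<in>UNIV. (\<Sum>l\<in>UNIV. residual T W $ i $ l
     * ((\<Sum>a=1..b. \<xi> a $ l * \<xi> a $ q) / real b)) * fst W $ j $ q)"
  unfolding batch_grad2_def
  by (simp add: matrix_matrix_mult_def transpose_def outer_square_component sum_divide_distrib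
      sum_distrib_left sum_distrib_right)
    (subst sum.swap, rule sum.cong, simp, subst sum.swap, simp)

section \<open>Degrees along the SGD recursion\<close>

context
  fixes S :: "nat \<Rightarrow> nat \<times> 'p \<times> 'p::finite \<Rightarrow> 'w \<Rightarrow> real" and C :: "nat \<times> 'p \<times> 'p \<Rightarrow> real"
    and x :: "nat \<Rightarrow> nat \<Rightarrow> nat \<Rightarrow> 'w \<Rightarrow> real^'p"
  assumes S: "\<And>b s j k \<omega>. S b (s, j, k) \<omega> = (\<Sum>a=1..b. x b s a \<omega> $ j * x b s a \<omega> $ k) / real b"
begin

lemma polynomial_in_var:
  "polynomial_in S C 1 (\<lambda>b \<omega>. (\<Sum>a=1..b. x b s a \<omega> $ j * x b s a \<omega> $ k) / real b)"
  unfolding polynomial_in_def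
  using poly_family.mult_var[OF poly_family.const, of S C 0 "(s, j, k)" 1] by (auto simp: S)

lemma polynomial_in_residual:
  assumes "\<And>i j. polynomial_in S C d (\<lambda>b \<omega>. fst (W b \<omega>) $ i $ j)" "\<And>i j. polynomial_in S C d (\<lambda>b \<omega>. snd (W b \<omega>) $ i $ j)"
  shows "polynomial_in S C (d + d) (\<lambda>b \<omega>. residual T (W b \<omega>) $ i $ j)"
proof -
  have "polynomial_in S C (d + d) (\<lambda>b \<omega>. (\<Sum>q\<in>UNIV. snd (W b \<omega>) $ i $ q * fst (W b \<omega>) $ q $ j)
      - 1 * (snd T ** fst T) $ i $ j)"
    by (intro polynomial_in_diff_scale polynomial_in_sum polynomial_in_mult polynomial_in_const assms) simp
  then show ?thesis by (simp add: residual_def matrix_matrix_mult_def)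
qed

text \<open>Degree count: one layer gives \<open>d\<close>, the residual \<open>2 * d\<close>, the
  second-moment entry 1.\<close>

lemma polynomial_in_batch_grad:
  assumes W: "\<And>i j. polynomial_in S C d (\<lambda>b \<omega>. fst (W b \<omega>) $ i $ j)" "\<And>i j. polynomial_in S C d (\<lambda>b \<omega>. snd (W b \<omega>) $ i $ j)"
    and e: "3 * d + 1 \<le> e"
  shows "polynomial_in S C e (\<lambda>b \<omega>. batch_grad1 T b (\<lambda>i. x b s i \<omega>) (W b \<omega>) $ i $ j)"
    and "polynomial_in S C e (\<lambda>b \<omega>. batch_grad2 T b (\<lambda>i. x b s i \<omega>) (W b \<omega>) $ k $ l)"
proof -
  have "polynomial_in S C ((d + (d + d)) + 1) (\<lambda>b \<omega>. batch_grad1 T b (\<lambda>i. x b s i \<omega>) (W b \<omega>) $ i $ j)"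
    unfolding batch_grad1_component
    by (intro polynomial_in_sum polynomial_in_mult polynomial_in_residual polynomial_in_var W) auto
  then show "polynomial_in S C e (\<lambda>b \<omega>. batch_grad1 T b (\<lambda>i. x b s i \<omega>) (W b \<omega>) $ i $ j)"
    by (rule polynomial_in_mono) (use e in simp)
  have "polynomial_in S C (((d + d) + 1) + d) (\<lambda>b \<omega>. batch_grad2 T b (\<lambda>i. x b s i \<omega>) (W b \<omega>) $ k $ l)"
    unfolding batch_grad2_component
    by (intro polynomial_in_sum polynomial_in_mult polynomial_in_residual polynomial_in_var W) auto
  then show "polynomial_in S C e (\<lambda>b \<omega>. batch_grad2 T b (\<lambda>i. x b s i \<omega>) (W b \<omega>) $ k $ l)"
    by (rule polynomial_in_mono) (use e in simp)
qed

lemma polynomial_in_sgd_weights: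
  "polynomial_in S C (3 ^ t - 1) (\<lambda>b \<omega>. fst (sgd_weights T \<alpha> W0 b (x b) t \<omega>) $ i $ j)"
  "polynomial_in S C (3 ^ t - 1) (\<lambda>b \<omega>. snd (sgd_weights T \<alpha> W0 b (x b) t \<omega>) $ k $ l)"
proof (induction t arbitrary: i j k l)
  case (Suc t)
  \<comment> \<open>Since \<open>3 * (3 ^ t - 1) + 1 = 3 ^ Suc t - 2\<close>, the bound holds with
    one to spare. The case split on \<open>3 ^ t\<close> disposes of truncated subtraction.\<close>
  have "3 * (3 ^ t - 1) + 1 \<le> (3::nat) ^ Suc t - 1"
    by (cases "(3::nat) ^ t") auto
  note g = polynomial_in_batch_grad[OF Suc.IH this]
  have mono: "(3::nat) ^ t - 1 \<le> 3 ^ Suc t - 1"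
    by (intro diff_le_mono) simp
  {
    case 1
    from polynomial_in_diff_scale[OF polynomial_in_mono[OF Suc.IH(1) mono] g(1)] show ?case
      by (simp add: Let_def del: power_Suc)
  next
    case 2
    from polynomial_in_diff_scale[OF polynomial_in_mono[OF Suc.IH(2) mono] g(2)] show ?case
      by (simp add: Let_def del: power_Suc)
  }
qed (simp_all add: polynomial_in_const)

lemma polynomial_in_sgd_grad:
  "polynomial_in S C (3 ^ (t + 1) - 1) (\<lambda>b \<omega>. sgd_grad1 T \<alpha> W0 b (x b) t \<omega> $ i $ j)"
  "polynomial_in S C (3 ^ (t + 1) - 1) (\<lambda>b \<omega>. sgd_grad2 T \<alpha> W0 b (x b) t \<omega> $ k $ l)"
proof -
  have "3 * (3 ^ t - 1) + 1 \<le> (3::nat) ^ (t + 1) - 1"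
    by (cases "(3::nat) ^ t") auto
  note g = polynomial_in_batch_grad[OF polynomial_in_sgd_weights this]
  show "polynomial_in S C (3 ^ (t + 1) - 1) (\<lambda>b \<omega>. sgd_grad1 T \<alpha> W0 b (x b) t \<omega> $ i $ j)"
    unfolding sgd_grad1_def by (rule g)
  show "polynomial_in S C (3 ^ (t + 1) - 1) (\<lambda>b \<omega>. sgd_grad2 T \<alpha> W0 b (x b) t \<omega> $ k $ l)"
    unfolding sgd_grad2_def by (rule g)
qed

end

lemma norm_vec_sq: "(norm (v :: real^'n))\<^sup>2 = (\<Sum>i\<in>UNIV. (v $ i)\<^sup>2)"
  unfolding power2_norm_eq_inner inner_vec_def by (simp add: power2_eq_square)

lemma (in prob_space) cond_var_trivial:
  fixes Z :: "'a \<Rightarrow> real^'n^'m"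
  assumes F: "sets F = {{}, space M}" "space F = space M"
    and int: "\<And>i j. integrable M (\<lambda>\<omega>. Z \<omega> $ i $ j)"
    and int2: "integrable M (\<lambda>\<omega>. \<Sum>ij\<in>UNIV. (Z \<omega> $ fst ij $ snd ij)\<^sup>2)"
  shows "AE \<omega> in M. cond_var M F Z \<omega>
    = expectation (\<lambda>\<omega>. \<Sum>ij\<in>UNIV. (Z \<omega> $ fst ij $ snd ij)\<^sup>2)
      - (\<Sum>ij\<in>UNIV. (expectation (\<lambda>\<omega>. Z \<omega> $ fst ij $ snd ij))\<^sup>2)"
proof -
  \<comment> \<open>There are finitely many entries, so their null sets combine into one.\<close>
  have "AE \<omega> in M. \<forall>ij. real_cond_exp M F (\<lambda>\<omega>. Z \<omega> $ fst ij $ snd ij) \<omega>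
      = expectation (\<lambda>\<omega>. Z \<omega> $ fst ij $ snd ij)"
    by (subst AE_all_countable) (auto intro!: real_cond_exp_trivial F int)
  moreover note real_cond_exp_trivial[OF F int2]
  ultimately show ?thesis
    by eventually_elim (simp add: cond_var_def norm_vec_sq vec_cond_exp_def vectorize_def)
qed

subsection \<open>The variance\<close>

lemma (in prob_space) cond_var_poly_family:
  fixes Z :: "nat \<Rightarrow> 'a \<Rightarrow> real^'n^'m"
  assumes expect: "\<And>d c f. poly_family S C d c f \<Longrightarrow> \<exists>p :: real poly. degree p \<le> d \<and> coeff p 0 = c \<and>
      (\<forall>b\<ge>1. integrable M (f b) \<and> expectation (f b) = poly p (1 / real b))"
    and Z: "\<And>i j. polynomial_in S C d (\<lambda>b \<omega>. Z b \<omega> $ i $ j)"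
    and F: "\<And>b. sets (F b) = {{}, space M}" "\<And>b. space (F b) = space M"
    and r: "2 * d \<le> r"
  shows "\<exists>\<beta> :: nat \<Rightarrow> real. \<forall>b\<ge>1. AE \<omega> in M.
    cond_var M (F b) (Z b) \<omega> = (\<Sum>k=1..r. \<beta> k * (1 / real b ^ k))"
proof -
  define f where "f ij = (\<lambda>b \<omega>. Z b \<omega> $ fst ij $ snd ij)" for ij :: "'m \<times> 'n"
  have "\<exists>c. poly_family S C d c (f ij)" for ij
    using Z unfolding f_def polynomial_in_def by blast
  \<comment> \<open>The values are fixed once here: the means and the second moment must share them
    for the constant terms to cancel.\<close>
  then obtain c where c: "\<And>ij. poly_family S C d (c ij) (f ij)"
    by metis
  with expect have "\<exists>p :: real poly. degree p \<le> d \<and> coeff p 0 = c ij \<and>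
      (\<forall>b\<ge>1. integrable M (f ij b) \<and> expectation (f ij b) = poly p (1 / real b))" for ij
    by blast
  then obtain p :: "'m \<times> 'n \<Rightarrow> real poly" where p: "\<And>ij. degree (p ij) \<le> d"
      "\<And>ij. coeff (p ij) 0 = c ij" "\<And>ij b. b \<ge> 1 \<Longrightarrow> integrable M (f ij b)"
      "\<And>ij b. b \<ge> 1 \<Longrightarrow> expectation (f ij b) = poly (p ij) (1 / real b)"
    by metis
  have "poly_family S C (d + d) (\<Sum>ij\<in>UNIV. c ij * c ij) (\<lambda>b \<omega>. \<Sum>ij\<in>UNIV. f ij b \<omega> * f ij b \<omega>)"
    by (intro poly_family_sum poly_family_mult c) simp
  from expect[OF this] obtain q :: "real poly" where q: "degree q \<le> d + d"
      "coeff q 0 = (\<Sum>ij\<in>UNIV. c ij * c ij)"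
      "\<And>b. b \<ge> 1 \<Longrightarrow> integrable M (\<lambda>\<omega>. \<Sum>ij\<in>UNIV. f ij b \<omega> * f ij b \<omega>)"
      "\<And>b. b \<ge> 1 \<Longrightarrow> expectation (\<lambda>\<omega>. \<Sum>ij\<in>UNIV. f ij b \<omega> * f ij b \<omega>) = poly q (1 / real b)"
    by blast
  define v where "v = q - (\<Sum>ij\<in>UNIV. p ij * p ij)"
  have "degree (p ij * p ij) \<le> r" for ij
    using degree_mult_le[of "p ij" "p ij"] p(1)[of ij] r by linarith
  then have deg: "degree v \<le> r"
    unfolding v_def using q(1) r by (intro degree_diff_le degree_sum_le) auto
  \<comment> \<open>Both the second moment and the squared means have constant term
    \<open>\<Sum>ij\<in>UNIV. c ij * c ij\<close>.\<close>
  have v0: "coeff v 0 = 0"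
    by (simp add: v_def q(2) coeff_sum coeff_mult_0 p(2))
  show ?thesis
  \<comment> \<open>\<open>v\<close> is built before \<open>b\<close> is fixed, so its coefficients
    are independent of \<open>b\<close>. Those beyond its degree are 0, which lets the sum run up to
    \<open>r\<close>.\<close>
  proof (intro exI[of _ "coeff v"] allI impI)
    fix b :: nat assume b: "b \<ge> 1"
    have "AE \<omega> in M. cond_var M (F b) (Z b) \<omega> = poly v (1 / real b)"
      using cond_var_trivial[OF F, of "Z b" b] p(3)[OF b, of "(_, _)"] p(4)[OF b] q(3,4)[OF b]
      by (simp add: f_def v_def power2_eq_square poly_sum)
    also have "poly v (1 / real b) = (\<Sum>k\<le>r. coeff v k * (1 / real b) ^ k)"
      unfolding poly_altdef using deg
      by (intro sum.mono_neutral_left) (auto simp: coeff_eq_0)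
    also have "\<dots> = (\<Sum>k=1..r. coeff v k * (1 / real b ^ k))"
      using v0 by (simp add: atMost_atLeast0 sum.atLeast_Suc_atMost power_one_over)
    finally show "AE \<omega> in M. cond_var M (F b) (Z b) \<omega>
      = (\<Sum>k=1..r. coeff v k * (1 / real b ^ k))" .
  qed
qed

theorem theorem4:
  fixes M :: "'w measure"
    and T :: "(real^'p^'k) \<times> (real^'k^'o)"
    and W0 :: "(real^'p^'h) \<times> (real^'h^'o)"
    and \<alpha> :: "nat \<Rightarrow> real"
    and x :: "nat \<Rightarrow> nat \<Rightarrow> nat \<Rightarrow> 'w \<Rightarrow> real^'p"
    and t :: nat
  assumes "prob_space M"
    and "\<And>s. \<alpha> s > 0"
    and "\<And>b. b \<ge> 1 \<Longrightarrow>
      prob_space.indep_vars M (\<lambda>_. borel) (\<lambda>(s, i). x b s i) (UNIV \<times> {1..b})"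
    and "\<And>b s i. b \<ge> 1 \<Longrightarrow> i \<in> {1..b} \<Longrightarrow>
      distributed M lborel (x b s i) (\<lambda>v. ennreal (std_normal_vec_density v))"
  shows
    "(\<exists>r \<le> 2 * 3 ^ (t + 1). \<exists>\<beta> :: nat \<Rightarrow> real. \<forall>b \<ge> 1. AE \<omega> in M.
        cond_var M (initial_info M T \<alpha> W0 b (x b)) (sgd_grad1 T \<alpha> W0 b (x b) t) \<omega>
          = (\<Sum>k = 1..r. \<beta> k * (1 / real b ^ k))) \<and>
     (\<exists>r \<le> 2 * 3 ^ (t + 1). \<exists>\<beta> :: nat \<Rightarrow> real. \<forall>b \<ge> 1. AE \<omega> in M.
        cond_var M (initial_info M T \<alpha> W0 b (x b)) (sgd_grad2 T \<alpha> W0 b (x b) t) \<omega>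
          = (\<Sum>k = 1..r. \<beta> k * (1 / real b ^ k)))"
proof -
  interpret prob_space M by fact
  \<comment> \<open>The index \<open>(s, j, k)\<close> denotes entry \<open>(j, k)\<close> of the
    second moment matrix of iteration \<open>s\<close>. \<open>h\<close> ignores \<open>s\<close>;
    the iteration is selected by \<open>fst\<close>, in the role of \<open>\<sigma>\<close>.\<close>
  define h where "h = (\<lambda>(s :: nat, j, k) (v :: real^'p). v $ j * v $ k)"
  define S where "S = (\<lambda>b r \<omega>. (\<Sum>a=1..b. h r (x b (fst r) a \<omega>)) / real b)"
  define C where "C = (\<lambda>r. \<integral>v. h r v \<partial>std_normal_vec)"
  have S: "S b (s, j, k) \<omega> = (\<Sum>a=1..b. x b s a \<omega> $ j * x b s a \<omega> $ k) / real b" for b s j k \<omega>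
    by (simp add: S_def h_def)
  have law: "distr M borel (x b s i) = std_normal_vec" if "b \<ge> 1" "i \<in> {1..b}" for b s i
    using distributed_distr_eq_density[OF assms(4)[OF that]]
    by (simp add: std_normal_vec_def cong: distr_cong)
  have h_meas: "h r \<in> borel_measurable borel" for r
    by (cases r) (simp add: h_def)
  have h_int: "integrable std_normal_vec (\<lambda>v. \<Prod>n\<in>B. h (f n) v)"
    if "finite B" for B :: "nat set" and f
    using integrable_std_normal_vec_monomial[OF that, of "\<lambda>n. fst (snd (f n))" "\<lambda>n. snd (snd (f n))"]
    by (simp add: h_def case_prod_beta)
  have expect: "\<exists>p :: real poly. degree p \<le> d \<and> coeff p 0 = c \<and>
      (\<forall>b\<ge>1. integrable M (f b) \<and> expectation (f b) = poly p (1 / real b))"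
    if "poly_family S C d c f" for d c f
    using monomial_batch_mean[OF assms(3) law h_meas h_int] that
    unfolding S_def C_def by (rule expectation_poly_family)
  \<comment> \<open>The variance doubles the gradient degree \<open>3 ^ (t + 1) - 1\<close>. The
    largest permitted \<open>r\<close> is taken for both layers, with zero coefficients as
    padding.\<close>
  have r: "2 * (3 ^ (t + 1) - 1) \<le> (2 * 3 ^ (t + 1) :: nat)"
    by (intro mult_le_mono2) simp
  note grad = polynomial_in_sgd_grad[where S = S and C = C and x = x, OF S]
  show ?thesis
    by (intro conjI exI[of _ "2 * 3 ^ (t + 1) :: nat"] order.refl grad
        cond_var_poly_family[where S = S and C = C, OF expect _ sets_initial_info
          space_initial_info r])
qed

end
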